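(* Let $C$ be a constant and let $\mathbf{a}=(a_1\ge\cdots\ge a_C)$ be a sequence of non-negative integers encoded in unary. Let $b_n(\mathbf{a})$ be the number of $\mathbf{a}$-shifted ballot sequences $w_1,\ldots,w_n$ with $w_i\in\{1,\ldots,C\}$, that is, sequences such that for every $1\le i<C$ and every $j\le n$ we have $$\#\{k\mid w_k=i,\ k\le j\}+a_i\ \ge\ \#\{k\mid w_k=i+1,\ k\le j\}+a_{i+1}.$$ Then the function $(\mathbf{a},1^n)\mapsto b_n(\mathbf{a})$ is in $\#\mathsf{L}$.
   Context: The alphabet is $\Sigma=\{0,1\}$; $1^a$ is the string of $a$ ones; unary encoding of a tuple means $1^{a_1}\,0\,1^{a_2}\,0\cdots$ with $0$ as a delimiter. A function given only on strings of a specified form is extended by $0$ to all other strings. $\#\mathsf{L}$ is the class of functions $f:\Sigma^*\to\mathbb{N}_0$ such that $f(x)$ is the number of accepting computation paths on input $x$ of a fixed nondeterministic Turing machine with read-only input tape that uses $O(\log|x|)$ work space and halts on every computation path. Equivalently: there are a polynomial $q$ and a deterministic $O(\log|x|)$-space Turing machine $M$ with an additional read-once, left-to-right witness tape such that $f(x)=\#\{w\in\Sigma^{q(|x|)}\mid M(x,w)=\mathsf{yes}\}$. *)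

theory Defs
  imports Complex_Main "HOL-Library.Landau_Symbols"
begin

section \<open>Nondeterministic machines with a read-only input tape\<close>

text \<open>Strings over the alphabet of two letters are of type \<^typ>\<open>bool list\<close>, where
  \<^const>\<open>True\<close> is the letter 1 and \<^const>\<open>False\<close> is the letter 0. The input word is
  placed between two end markers.\<close>

datatype input_symbol = Left_End | Letter bool | Right_End

datatype direction = Move_Left | Stay | Move_Right

fun offset :: "direction \<Rightarrow> int" where
  "offset Move_Left = -1"
| "offset Stay = 0"
| "offset Move_Right = 1"

text \<open>A transition (q, a, s, q', s', d, e) applies in state q when the input head reads a and the
  work head reads s; it changes the state to q', writes s' on the work tape, and moves the
  input head by d and the work head by e.\<close>

record ('q, 's) ntm =
  states :: "'q set"
  symbols :: "'s set"
  blank :: 's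
  start :: 'q
  accepting :: "'q set"
  transitions :: "('q \<times> input_symbol \<times> 's \<times> 'q \<times> 's \<times> direction \<times> direction) set"

text \<open>The last two conditions keep the input head between the end markers. Without them, its
  position would be a counter that is not charged to the work space.\<close>

definition well_formed :: "('q, 's) ntm \<Rightarrow> bool" where
  "well_formed M \<longleftrightarrow>
     finite (states M) \<and> finite (symbols M) \<and>
     blank M \<in> symbols M \<and> start M \<in> states M \<and> accepting M \<subseteq> states M \<and>
     (\<forall>(q, a, s, q', s', d, e) \<in> transitions M.
        q \<in> states M \<and> s \<in> symbols M \<and> q' \<in> states M \<and> s' \<in> symbols M \<and>
        (a = Left_End \<longrightarrow> d \<noteq> Move_Left) \<and> (a = Right_End \<longrightarrow> d \<noteq> Move_Right))"

datatype ('q, 's) config =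
  Config (state: 'q) (input_pos: int) (work_pos: int) (work_tape: "int \<Rightarrow> 's")

text \<open>The left end marker is at position 0, the letters are at positions 1 to \<^term>\<open>length x\<close>,
  and the right end marker is at position \<^term>\<open>length x + 1\<close>.\<close>

definition read_input :: "bool list \<Rightarrow> int \<Rightarrow> input_symbol" where
  "read_input x i =
     (if i \<le> 0 then Left_End
      else if i \<le> int (length x) then Letter (x ! nat (i - 1))
      else Right_End)"

definition initial :: "('q, 's) ntm \<Rightarrow> ('q, 's) config" where
  "initial M = Config (start M) 0 0 (\<lambda>_. blank M)"

inductive step :: "('q, 's) ntm \<Rightarrow> bool list \<Rightarrow> ('q, 's) config \<Rightarrow> ('q, 's) config \<Rightarrow> bool"
  for M :: "('q, 's) ntm" and x :: "bool list" where
  "(q, read_input x i, t h, q', s', d, e) \<in> transitions M \<Longrightarrow>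
     step M x (Config q i h t) (Config q' (i + offset d) (h + offset e) (t(h := s')))"

definition halted :: "('q, 's) ntm \<Rightarrow> bool list \<Rightarrow> ('q, 's) config \<Rightarrow> bool" where
  "halted M x c \<longleftrightarrow> (\<nexists>c'. step M x c c')"

text \<open>Computations may be partial, i.e. end in a configuration that has not halted. On a given
  configuration different transitions yield different successors, so that it does not matter
  whether sequences of configurations or of nondeterministic choices are counted.\<close>

definition computation :: "('q, 's) ntm \<Rightarrow> bool list \<Rightarrow> ('q, 's) config list \<Rightarrow> bool" where
  "computation M x p \<longleftrightarrow> p \<noteq> [] \<and> hd p = initial M \<and> successively (step M x) p"

definition accepting_path :: "('q, 's) ntm \<Rightarrow> bool list \<Rightarrow> ('q, 's) config list \<Rightarrow> bool" where
  "accepting_path M x p \<longleftrightarrow>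
     computation M x p \<and> halted M x (last p) \<and> state (last p) \<in> accepting M"

definition halts_on_every_path :: "('q, 's) ntm \<Rightarrow> bool" where
  "halts_on_every_path M \<longleftrightarrow>
     (\<forall>x. \<nexists>f :: nat \<Rightarrow> _. f 0 = initial M \<and> (\<forall>i. step M x (f i) (f (Suc i))))"

definition path_space :: "('q, 's) config list \<Rightarrow> nat" where
  "path_space p = card (work_pos ` set p)"

definition in_space :: "('q, 's) ntm \<Rightarrow> (nat \<Rightarrow> nat) \<Rightarrow> bool" where
  "in_space M s \<longleftrightarrow> (\<forall>x p. computation M x p \<longrightarrow> path_space p \<le> s (length x))"

text \<open>For a well-formed machine that halts on every path there are only finitely many accepting
  paths on each input, so \<^const>\<open>card\<close> is the number of these.\<close>

definition accepting_count :: "('q, 's) ntm \<Rightarrow> bool list \<Rightarrow> nat" where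
  "accepting_count M x = card {p. accepting_path M x p}"

text \<open>As sets of states and symbols are finite, it is no restriction to take them from
  \<^typ>\<open>nat\<close>.\<close>

definition sharpL :: "(bool list \<Rightarrow> nat) set" where
  "sharpL = {accepting_count M | M :: (nat, nat) ntm.
     well_formed M \<and> halts_on_every_path M \<and>
     (\<exists>s. in_space M s \<and> (\<lambda>n. real (s n)) \<in> O(\<lambda>n. ln (real n)))}"


section \<open>Encodings\<close>

text \<open>The function \<^term>\<open>f\<close> with domain \<^term>\<open>D\<close>, as a function on strings, where
  \<^term>\<open>enc\<close> is an encoding that is injective on \<^term>\<open>D\<close>.\<close>

definition on_strings :: "('a \<Rightarrow> bool list) \<Rightarrow> 'a set \<Rightarrow> ('a \<Rightarrow> nat) \<Rightarrow> bool list \<Rightarrow> nat" where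
  "on_strings enc D f x = (if x \<in> enc ` D then f (inv_into D enc x) else 0)"

definition unary_tuple :: "nat list \<Rightarrow> bool list" where
  "unary_tuple a = concat (map (\<lambda>k. replicate k True @ [False]) a)"

text \<open>Each entry of the tuple is followed by the delimiter 0, and then there are n ones. Equivalently,
  the entries of the tuple and n are separated by the delimiter.\<close>

fun encode :: "nat list \<times> nat \<Rightarrow> bool list" where
  "encode (a, n) = unary_tuple a @ replicate n True"

lemma on_strings_encoded:
  assumes "inj_on enc D" and "y \<in> D"
  shows "on_strings enc D f (enc y) = f y"
  using assms by (simp add: on_strings_def)

lemma replicate_True_append_False_inject:
  "replicate k True @ False # x = replicate l True @ False # y \<longleftrightarrow> k = l \<and> x = y"
proof (induction k arbitrary: l)
  case 0
  then show ?case by (cases l) auto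
next
  case (Suc k)
  then show ?case by (cases l) auto
qed

lemma encode_inject:
  "length a = length b \<Longrightarrow> encode (a, m) = encode (b, n) \<Longrightarrow> a = b \<and> m = n"
proof (induction a b rule: list_induct2)
  case Nil
  then show ?case by (auto simp: unary_tuple_def dest: arg_cong [of _ _ length])
next
  case (Cons k a l b)
  then show ?case by (simp add: unary_tuple_def replicate_True_append_False_inject)
qed

lemma inj_on_encode: "inj_on encode {(a, n). length a = C \<and> P a}"
  by (rule inj_onI) (clarsimp simp del: encode.simps, metis encode_inject)


section \<open>Shifted ballot sequences\<close>

text \<open>The list a has its entries at indices 0 to C - 1, hence \<^term>\<open>a ! (i - 1)\<close> for the
  i-th entry.\<close>

definition shifted_ballot :: "nat list \<Rightarrow> nat list \<Rightarrow> bool" where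
  "shifted_ballot a w \<longleftrightarrow>
     set w \<subseteq> {1..length a} \<and>
     (\<forall>i \<in> {1..<length a}. \<forall>j \<le> length w.
        count_list (take j w) i + a ! (i - 1) \<ge> count_list (take j w) (i + 1) + a ! i)"

definition ballot_number :: "nat \<Rightarrow> nat list \<Rightarrow> nat" where
  "ballot_number n a = card {w. length w = n \<and> shifted_ballot a w}"

end

theory Submission
  imports Defs "HOL-Library.Nat_Bijection" "HOL-Library.Countable"
begin

text \<open>The machine reads the input from left to right once. Appending the letter i to a sequence
  is the same act whether the sequence is a ballot sequence with shift \<open>a\<close> or the
  unshifted sequence \<open>1 \<dots> 1 2 \<dots> 2 \<dots> C \<dots> C\<close> in which i occurs \<open>a ! (i - 1)\<close> times: the
  latter is a ballot sequence iff \<open>a\<close> is weakly decreasing, and then the ballot sequences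
  with shift \<open>a\<close> are the continuations that keep the ballot condition. So the machine
  appends the letter i for each 1 in the i-th block of the input, and a
  nondeterministically chosen letter for each 1 after the last delimiter. It rejects when
  a letter violates the condition, and when the number of delimiters is wrong. The
  accepting paths on an encoding of \<open>(a, n)\<close> then correspond to the ballot sequences of
  length n with shift \<open>a\<close>, and other words have no accepting path; the recursion \<open>runs\<close>
  expresses this count, and \<open>runs_eq_on_strings\<close> identifies it with the function in
  question.

  To test the condition, it suffices to know the differences of the heights of consecutive
  letters. These are at most the length of the input, and appending a letter increments
  one of them and, unless it is the first letter, decrements another, which must not be 0
  before. The machine keeps them as binary counters that share the cells of the work tape,
  which takes logarithmic space. For an increment in progress at digit j the invariant is
  that \<open>2 ^ j\<close> remains to be added to the present value of the counter (\<open>yields_Inc\<close>), and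
  for a decrement that \<open>2 ^ j\<close> remains to be subtracted (\<open>yields_Dec\<close>). Induction on the
  unread part of the input then shows that the machine has \<open>runs\<close> many accepting paths
  (\<open>yields_Main\<close>).\<close>

section \<open>Counting accepting paths along the computation tree\<close>

text \<open>The computation tree below the configuration c is finite, k of its leaves are accepting,
  and the work head stays within P. An inductive definition yields termination, the number
  of accepting paths and the space bound by one derivation that follows the computation.\<close>

inductive counted ::
  "('q, 's) ntm \<Rightarrow> bool list \<Rightarrow> int set \<Rightarrow> ('q, 's) config \<Rightarrow> nat \<Rightarrow> bool"
  for M :: "('q, 's) ntm" and x :: "bool list" and P :: "int set" where
  halted: "work_pos c \<in> P \<Longrightarrow> halted M x c \<Longrightarrow>
     counted M x P c (if state c \<in> accepting M then 1 else 0)"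
| branch: "work_pos c \<in> P \<Longrightarrow> \<not> halted M x c \<Longrightarrow> finite {c'. step M x c c'} \<Longrightarrow>
     (\<And>c'. step M x c c' \<Longrightarrow> counted M x P c' (g c')) \<Longrightarrow>
     counted M x P c (\<Sum>c' | step M x c c'. g c')"

text \<open>The accepting paths that start in c instead of the initial configuration.\<close>

definition accepting_paths_from ::
  "('q, 's) ntm \<Rightarrow> bool list \<Rightarrow> ('q, 's) config \<Rightarrow> ('q, 's) config list set" where
  "accepting_paths_from M x c =
     {p. p \<noteq> [] \<and> hd p = c \<and> successively (step M x) p \<and>
         halted M x (last p) \<and> state (last p) \<in> accepting M}"

lemma accepting_paths_from_halted:
  assumes "halted M x c"
  shows "accepting_paths_from M x c = (if state c \<in> accepting M then {[c]} else {})"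
proof -
  have "successively (step M x) (c # q) \<longleftrightarrow> q = []" for q
    using assms by (cases q) (auto simp: halted_def)
  then have "p \<in> accepting_paths_from M x c \<longleftrightarrow> p = [c] \<and> state c \<in> accepting M" for p
    using assms by (cases p) (auto simp: accepting_paths_from_def)
  then show ?thesis by auto
qed

lemma accepting_paths_from_step:
  assumes "\<not> halted M x c"
  shows "accepting_paths_from M x c =
      (\<Union>c' \<in> {c'. step M x c c'}. (#) c ` accepting_paths_from M x c')"
    (is "?l = ?r")
proof (intro equalityI subsetI)
  fix p assume p: "p \<in> ?l"
  then have "tl p \<noteq> []"
    using assms by (cases p) (auto simp: accepting_paths_from_def)
  with p show "p \<in> ?r"
    by (cases p; cases "tl p") (auto simp: accepting_paths_from_def)
next
  fix p assume "p \<in> ?r"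
  then show "p \<in> ?l"
    by (auto simp: accepting_paths_from_def neq_Nil_conv)
qed

lemma counted_paths:
  assumes "counted M x P c k"
  shows "finite (accepting_paths_from M x c) \<and> card (accepting_paths_from M x c) = k"
  using assms
proof induction
  case (halted c)
  then show ?case by (simp add: accepting_paths_from_halted)
next
  case (branch c g)
  have "card (accepting_paths_from M x c)
      = (\<Sum>c' | step M x c c'. card ((#) c ` accepting_paths_from M x c'))"
    unfolding accepting_paths_from_step [OF branch.hyps(2)]
    using branch by (intro card_UN_disjoint) (auto simp: accepting_paths_from_def)
  also have "\<dots> = (\<Sum>c' | step M x c c'. g c')"
    using branch by (intro sum.cong) (auto simp: card_image)
  finally show ?case
    using branch by (simp add: accepting_paths_from_step)
qed

lemma counted_work_pos:
  assumes "counted M x P c k" and "p \<noteq> []" and "hd p = c" and "successively (step M x) p"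
  shows "work_pos ` set p \<subseteq> P"
  using assms
proof (induction arbitrary: p)
  case (halted c)
  then show ?case by (cases p; cases "tl p") (auto simp: halted_def)
next
  case (branch c g)
  show ?case
  proof (cases "tl p = []")
    case True
    with branch show ?thesis by (cases p) auto
  next
    case False
    with branch.prems have p: "p = c # tl p"
      "step M x c (hd (tl p))" "successively (step M x) (tl p)"
      by (cases p; cases "tl p"; simp)+
    with branch.IH [OF p(2) False] have "work_pos ` set (tl p) \<subseteq> P" by simp
    with branch.hyps(1) have "work_pos ` set (c # tl p) \<subseteq> P" by simp
    with p(1) show ?thesis by simp
  qed
qed

lemma counted_terminates:
  assumes "counted M x P c k"
  shows "\<nexists>f :: nat \<Rightarrow> _. f 0 = c \<and> (\<forall>i. step M x (f i) (f (Suc i)))"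
  using assms
proof induction
  case (halted c)
  then show ?case by (metis halted_def)
next
  case (branch c g)
  show ?case
  proof
    assume "\<exists>f. f 0 = c \<and> (\<forall>i. step M x (f i) (f (Suc i)))"
    then obtain f where "f 0 = c" and f: "\<And>i. step M x (f i) (f (Suc i))" by blast
    then have "step M x c (f (Suc 0))" by metis
    from branch.IH [OF this] f show False
      by (auto dest!: spec [of _ "\<lambda>i. f (Suc i)"])
  qed
qed

lemma sharpL_if_counted:
  fixes M :: "(nat, nat) ntm"
  assumes "well_formed M"
    and count: "\<And>x. counted M x (P (length x)) (initial M) (f x)"
    and fin: "\<And>n. finite (P n)"
    and space: "(\<lambda>n. real (card (P n))) \<in> O(\<lambda>n. ln (real n))"
  shows "f \<in> sharpL"
proof -
  have "accepting_count M = f"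
  proof
    fix x
    have "{p. accepting_path M x p} = accepting_paths_from M x (initial M)"
      by (auto simp: accepting_path_def accepting_paths_from_def computation_def)
    then show "accepting_count M x = f x"
      using counted_paths [OF count] by (simp add: accepting_count_def)
  qed
  moreover have "halts_on_every_path M"
    unfolding halts_on_every_path_def using counted_terminates [OF count] by blast
  moreover have "in_space M (\<lambda>n. card (P n))"
    unfolding in_space_def path_space_def computation_def
    by (intro allI impI card_mono fin) (elim conjE, rule counted_work_pos [OF count])
  ultimately show ?thesis
    unfolding sharpL_def using assms(1) space by blast
qed

section \<open>A recursion along the input word\<close>

text \<open>The heights of the letters, i.e. their initial values plus the numbers of their
  occurrences so far, are a list h. The letter that the ballot sequence calls i + 1 has
  index i in this list. Appending it to the sequence increases its height.\<close>

definition add_at :: "nat \<Rightarrow> nat list \<Rightarrow> nat list" where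
  "add_at i h = h[i := Suc (h ! i)]"

text \<open>The heights are in weakly decreasing order throughout; the letter with index i may be
  appended if this preserves the order.\<close>

definition addable :: "nat \<Rightarrow> nat list \<Rightarrow> bool" where
  "addable i h \<longleftrightarrow> i = 0 \<or> h ! i < h ! (i - 1)"

text \<open>The number of ways to read the remaining word s in phase p with heights h. In a phase p
  less than the length of h, each 1 appends the letter with index p, and 0 ends the phase;
  so if all heights are 0 at first, an entry of the tuple raises the height p from 0 to
  that entry, and there is no way to read it if it exceeds the previous entry. In the last
  phase, each 1 appends a letter of free choice and a 0 is an error.\<close>

fun runs :: "nat \<Rightarrow> nat list \<Rightarrow> bool list \<Rightarrow> nat" where
  "runs p h [] = (if p = length h then 1 else 0)"
| "runs p h (False # s) = (if p < length h then runs (Suc p) h s else 0)"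
| "runs p h (True # s) =
     (\<Sum>i \<in> (if p < length h then {p} else {..<length h}).
        if addable i h then runs p (add_at i h) s else 0)"

lemma length_add_at [simp]: "length (add_at i h) = length h"
  by (simp add: add_at_def)

lemma sorted_ge_iff_nth:
  "sorted_wrt (\<ge>) (h :: nat list) \<longleftrightarrow> (\<forall>i. Suc i < length h \<longrightarrow> h ! Suc i \<le> h ! i)"
  by (subst sorted_wrt_iff_nth_Suc_transp) (auto simp: transp_def)

lemma sorted_add_at_iff:
  assumes "sorted_wrt (\<ge>) h" and "i < length h"
  shows "sorted_wrt (\<ge>) (add_at i h) \<longleftrightarrow> addable i h"
  using assms unfolding sorted_ge_iff_nth addable_def add_at_def
  by (cases i) (auto simp: nth_list_update Suc_le_eq le_SucI)

lemma shifted_ballot_sorted: "shifted_ballot a w \<Longrightarrow> sorted_wrt (\<ge>) a"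
  unfolding sorted_ge_iff_nth
proof (intro allI impI)
  fix i assume "shifted_ballot a w" and "Suc i < length a"
  then have "count_list (take 0 w) (Suc i) + a ! (Suc i - 1)
      \<ge> count_list (take 0 w) (Suc i + 1) + a ! Suc i"
    unfolding shifted_ballot_def
    by (metis One_nat_def atLeastLessThan_iff le0 le_add1 plus_1_eq_Suc)
  then show "a ! Suc i \<le> a ! i" by simp
qed

lemma shifted_ballot_Nil: "shifted_ballot a [] \<longleftrightarrow> sorted_wrt (\<ge>) a"
proof -
  have "shifted_ballot a []" if "sorted_wrt (\<ge>) a"
    using that unfolding shifted_ballot_def sorted_ge_iff_nth
    by (auto simp: Suc_le_eq gr0_conv_Suc)
  then show ?thesis using shifted_ballot_sorted by blast
qed

lemma shifted_ballot_Cons: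
  assumes "sorted_wrt (\<ge>) a"
  shows "shifted_ballot a (v # w) \<longleftrightarrow> v \<in> {1..length a} \<and> shifted_ballot (add_at (v - 1) a) w"
proof (cases "v \<in> {1..length a}")
  case True
  have eq: "count_list (take (Suc j) (v # w)) i + a ! (i - 1)
      = count_list (take j w) i + add_at (v - 1) a ! (i - 1)"
    if "i \<in> {1..length a}" for i j
    using that True by (auto simp: add_at_def nth_list_update)
  have all: "(\<forall>j \<le> length (v # w). Q j) \<longleftrightarrow> Q 0 \<and> (\<forall>j \<le> length w. Q (Suc j))" for Q
    by (metis Suc_le_mono length_Cons not0_implies_Suc zero_le)
  have "(\<forall>j \<le> length (v # w). count_list (take j (v # w)) i + a ! (i - 1)
            \<ge> count_list (take j (v # w)) (i + 1) + a ! i)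
      \<longleftrightarrow> (\<forall>j \<le> length w. count_list (take j w) i + add_at (v - 1) a ! (i - 1)
            \<ge> count_list (take j w) (i + 1) + add_at (v - 1) a ! i)"
    if i: "i \<in> {1..<length a}" for i
    unfolding all using eq [of i] eq [of "i + 1"] i assms
    by (auto simp: sorted_ge_iff_nth dest: spec [of _ "i - 1"] simp del: take_Suc_Cons)
  with True show ?thesis
    unfolding shifted_ballot_def by auto
qed (auto simp: shifted_ballot_def)

lemma ballot_number_0: "sorted_wrt (\<ge>) a \<Longrightarrow> ballot_number 0 a = 1"
proof -
  assume "sorted_wrt (\<ge>) a"
  then have "{w. length w = 0 \<and> shifted_ballot a w} = {[]}"
    by (auto simp: shifted_ballot_Nil)
  then show ?thesis by (simp add: ballot_number_def)
qed

lemma finite_ballots: "finite {w. length w = n \<and> shifted_ballot a w}"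
  by (rule finite_subset [OF _ finite_lists_length_eq [of "{1..length a}" n]])
    (auto simp: shifted_ballot_def)

text \<open>Splitting by the first letter: what remains is a ballot sequence shifted by the new
  heights.\<close>

lemma ballot_number_Suc:
  assumes "sorted_wrt (\<ge>) a"
  shows "ballot_number (Suc n) a
    = (\<Sum>i<length a. if addable i a then ballot_number n (add_at i a) else 0)"
proof -
  let ?B = "\<lambda>i. {w. length w = n \<and> shifted_ballot (add_at i a) w}"
  have "{w. length w = Suc n \<and> shifted_ballot a w} = (\<Union>i<length a. (#) (Suc i) ` ?B i)"
    by (auto simp: shifted_ballot_Cons [OF assms] length_Suc_conv image_iff Suc_le_eq gr0_conv_Suc)
  then have "ballot_number (Suc n) a = card (\<Union>i<length a. (#) (Suc i) ` ?B i)"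
    by (simp add: ballot_number_def)
  also have "\<dots> = (\<Sum>i<length a. card ((#) (Suc i) ` ?B i))"
    by (intro card_UN_disjoint) (auto simp: finite_ballots)
  also have "\<dots> = (\<Sum>i<length a. ballot_number n (add_at i a))"
    by (simp add: card_image ballot_number_def)
  also have "\<dots> = (\<Sum>i<length a. if addable i a then ballot_number n (add_at i a) else 0)"
  proof (intro sum.cong refl)
    fix i assume "i \<in> {..<length a}"
    then have "?B i = {}" if "\<not> addable i a"
      using that sorted_add_at_iff [OF assms] shifted_ballot_sorted by blast
    then show "ballot_number n (add_at i a)
        = (if addable i a then ballot_number n (add_at i a) else 0)"
      unfolding ballot_number_def by (metis card.empty)
  qed
  finally show ?thesis .
qed

lemma runs_replicate_True:
  "sorted_wrt (\<ge>) a \<Longrightarrow> runs (length a) a (replicate n True) = ballot_number n a"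
proof (induction n arbitrary: a)
  case 0
  then show ?case by (simp add: ballot_number_0)
next
  case (Suc n)
  have "runs (length a) (add_at i a) (replicate n True) = ballot_number n (add_at i a)"
    if "i < length a" "addable i a" for i
    using Suc.IH [of "add_at i a"] sorted_add_at_iff [OF Suc.prems] that by simp
  then show ?case
    by (auto simp: ballot_number_Suc [OF Suc.prems] intro!: sum.cong)
qed

lemma runs_block:
  "runs (length b) (b @ j # r) (replicate k True @ False # s) =
     (if k = 0 \<or> b = [] \<or> j + k \<le> last b then runs (Suc (length b)) (b @ (j + k) # r) s else 0)"
proof (induction k arbitrary: j)
  case (Suc k)
  have "addable (length b) (b @ j # r) \<longleftrightarrow> b = [] \<or> j < last b"
    by (cases b rule: rev_cases) (auto simp: addable_def nth_append)
  then have "runs (length b) (b @ j # r) (replicate (Suc k) True @ False # s) =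
      (if b = [] \<or> j < last b
       then runs (length b) (b @ Suc j # r) (replicate k True @ False # s) else 0)"
    by (simp add: add_at_def)
  then show ?case
    unfolding Suc.IH by auto
qed simp

text \<open>Reading the encoded tuple a checks that it is weakly decreasing, and puts its entries in
  place of the zeros among the heights.\<close>

lemma runs_unary_tuple:
  "sorted_wrt (\<ge>) b \<Longrightarrow>
    runs (length b) (b @ replicate (length a) 0) (unary_tuple a @ s) =
      (if sorted_wrt (\<ge>) (b @ a) then runs (length (b @ a)) (b @ a) s else 0)"
proof (induction a arbitrary: b)
  case Nil
  then show ?case by (simp add: unary_tuple_def)
next
  case (Cons k a)
  have "sorted_wrt (\<ge>) (b @ [k]) \<longleftrightarrow> k = 0 \<or> b = [] \<or> k \<le> last b"
    using Cons.prems by (cases b rule: rev_cases) (auto simp: sorted_wrt_append)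
  moreover have "sorted_wrt (\<ge>) (b @ [k])" if "sorted_wrt (\<ge>) (b @ k # a)"
    using that by (auto simp: sorted_wrt_append)
  ultimately show ?case
    using Cons.IH [of "b @ [k]"] runs_block [of b 0 "replicate (length a) 0" k "unary_tuple a @ s"]
    by (auto simp: unary_tuple_def)
qed

lemma runs_nonzero_imp_encoded:
  "runs p h s \<noteq> 0 \<Longrightarrow> p \<le> length h \<Longrightarrow> \<exists>a n. length a = length h - p \<and> s = encode (a, n)"
proof (induction p h s rule: runs.induct)
  case (1 p h)
  then show ?case
    by (intro exI [of _ "[]"] exI [of _ 0]) (auto simp: unary_tuple_def split: if_splits)
next
  case (2 p h s)
  then obtain a n where "length a = length h - Suc p" "s = encode (a, n)" "p < length h"
    by (auto split: if_splits)
  then show ?case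
    by (intro exI [of _ "0 # a"] exI [of _ n]) (auto simp: unary_tuple_def)
next
  case (3 p h s)
  obtain i where i: "i \<in> (if p < length h then {p} else {..<length h})"
    and nz: "addable i h" "runs p (add_at i h) s \<noteq> 0"
    using 3(2) unfolding runs.simps
    by (rule sum.not_neutral_contains_not_neutral) (auto split: if_split_asm)
  from 3(1) [OF i nz] 3(3) obtain a n where an: "length a = length h - p" "s = encode (a, n)"
    by auto
  show ?case
  proof (cases "p < length h")
    case True
    with an obtain k a' where "a = k # a'" by (cases a) auto
    with an show ?thesis
      by (intro exI [of _ "Suc k # a'"] exI [of _ n]) (auto simp: unary_tuple_def)
  next
    case False
    with an show ?thesis
      by (intro exI [of _ "[]"] exI [of _ "Suc n"]) (auto simp: unary_tuple_def)
  qed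
qed

lemma runs_eq_on_strings:
  "runs 0 (replicate C 0) x =
    on_strings encode {(a, n). length a = C \<and> sorted_wrt (\<ge>) a} (\<lambda>(a, n). ballot_number n a) x"
    (is "_ = on_strings encode ?D _ x")
proof -
  have runs_encode: "runs 0 (replicate C 0) (encode (a, n))
      = (if sorted_wrt (\<ge>) a then ballot_number n a else 0)" if "length a = C" for a n
    using runs_unary_tuple [of "[]" a "replicate n True"] that runs_replicate_True by auto
  show ?thesis
  proof (cases "x \<in> encode ` ?D")
    case True
    then obtain a n where "x = encode (a, n)" "length a = C" "sorted_wrt (\<ge>) a" by auto
    then show ?thesis
      using on_strings_encoded [OF inj_on_encode [of C "sorted_wrt (\<ge>)"], of "(a, n)"] runs_encode
      by (simp del: encode.simps)
  next
    case False
    have "runs 0 (replicate C 0) x = 0"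
    proof (rule ccontr)
      assume nz: "\<not> ?thesis"
      then obtain a n where "length a = C" "x = encode (a, n)"
        using runs_nonzero_imp_encoded [of 0 "replicate C 0" x]
        by (metis diff_zero le0 length_replicate)
      with nz runs_encode have "x \<in> encode ` ?D"
        by (auto simp del: encode.simps split: if_splits)
      with False show False ..
    qed
    with False show ?thesis by (simp add: on_strings_def)
  qed
qed

section \<open>A machine with binary counters\<close>

text \<open>The states of the machine. In \<^term>\<open>Main p\<close> it is in phase p of the recursion and reads the
  input; the other states work on the counters and leave the input head in place. The
  counter k holds the difference of the heights k and k + 1. To append the letter with
  index i, \<^term>\<open>Dec k p\<close> decrements the counter k = i - 1, unless i = 0, and fails if it is
  0; then \<^term>\<open>Inc i p\<close> increments the counter i and returns to phase p. Each completed sweep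
  over the digits goes from the least significant one upwards and is followed by
  \<^term>\<open>Rewind q\<close>, which moves the work head back to position 0 and enters q.\<close>

datatype control = Main nat | Dec nat nat | Inc nat nat | Rewind control | Accept

instance control :: countable
  by countable_datatype

text \<open>The state that begins to append the letter with index i.\<close>

definition first_sweep :: "nat \<Rightarrow> nat \<Rightarrow> control" where
  "first_sweep i p = (case i of 0 \<Rightarrow> Inc 0 p | Suc k \<Rightarrow> Dec k p)"

text \<open>The possible moves from a state, given the scanned input symbol and the scanned work cell.
  A cell contains a set: the counters whose digit there is 1 and, if the cell is in use,
  also C as a marker. The blank cell is the empty set. So C counters share the cells, one
  binary digit of each per cell. A decrement that reaches a blank cell has met no digit 1,
  hence the counter was 0, and the machine halts. Only \<^term>\<open>Accept\<close> is accepting, as the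
  machine also halts in other states upon an error.\<close>

fun moves ::
  "nat \<Rightarrow> control \<Rightarrow> input_symbol \<Rightarrow> nat set \<Rightarrow> (control \<times> nat set \<times> direction \<times> direction) set"
where
  "moves C (Main p) Left_End S = {(Main p, S, Move_Right, Stay)}"
| "moves C (Main p) (Letter False) S =
     (if p < C then {(Main (Suc p), S, Move_Right, Stay)} else {})"
| "moves C (Main p) (Letter True) S =
     (\<lambda>i. (first_sweep i p, S, Move_Right, Stay)) ` (if p < C then {p} else {..<C})"
| "moves C (Main p) Right_End S = (if p = C then {(Accept, S, Stay, Stay)} else {})"
| "moves C (Dec k p) a S =
     (if C \<notin> S then {}
      else if k \<in> S then {(Rewind (Inc (Suc k) p), S - {k}, Stay, Move_Left)}
      else {(Dec k p, insert k S, Stay, Move_Right)})"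
| "moves C (Inc i p) a S =
     (if i \<in> S then {(Inc i p, S - {i}, Stay, Move_Right)}
      else {(Rewind (Main p), insert C (insert i S), Stay, Move_Left)})"
| "moves C (Rewind q) a S =
     (if C \<in> S then {(Rewind q, S, Stay, Move_Left)} else {(q, S, Stay, Move_Right)})"
| "moves C Accept a S = {}"

text \<open>The finitely many states that the machine for C letters uses.\<close>

fun is_control :: "nat \<Rightarrow> control \<Rightarrow> bool" where
  "is_control C (Main p) \<longleftrightarrow> p \<le> C"
| "is_control C (Dec k p) \<longleftrightarrow> Suc k < C \<and> p \<le> C"
| "is_control C (Inc i p) \<longleftrightarrow> i < C \<and> p \<le> C"
| "is_control C (Rewind (Main p)) \<longleftrightarrow> p \<le> C"
| "is_control C (Rewind (Inc i p)) \<longleftrightarrow> i < C \<and> p \<le> C"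
| "is_control C (Rewind _) \<longleftrightarrow> False"
| "is_control C Accept \<longleftrightarrow> True"

text \<open>States and cell contents are represented by natural numbers.\<close>

definition ballot_machine :: "nat \<Rightarrow> (nat, nat) ntm" where
  "ballot_machine C =
     \<lparr>states = to_nat ` {q. is_control C q},
      symbols = set_encode ` Pow {..C},
      blank = set_encode {},
      start = to_nat (Main 0),
      accepting = {to_nat Accept},
      transitions =
        {(to_nat q, a, set_encode S, to_nat q', set_encode S', d, e) | q a S q' S' d e.
           is_control C q \<and> S \<subseteq> {..C} \<and> (q', S', d, e) \<in> moves C q a S}\<rparr>"

lemma finite_controls: "finite {q. is_control C q}"
proof -
  let ?N = "{..C} \<times> {..C}"
  have "{q. is_control C q} \<subseteq> Main ` {..C} \<union> (\<lambda>(k, p). Dec k p) ` ?N \<union> (\<lambda>(k, p). Inc k p) ` ?N \<union>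
      (\<lambda>p. Rewind (Main p)) ` {..C} \<union> (\<lambda>(k, p). Rewind (Inc k p)) ` ?N \<union> {Accept}"
    (is "_ \<subseteq> ?R")
  proof
    fix q assume "q \<in> {q. is_control C q}"
    then show "q \<in> ?R"
      by (cases "(C, q)" rule: is_control.cases) (auto simp: image_iff)
  qed
  then show ?thesis
    by (rule finite_subset) auto
qed

lemma is_control_first_sweep: "i < C \<Longrightarrow> p \<le> C \<Longrightarrow> is_control C (first_sweep i p)"
  by (auto simp: first_sweep_def split: nat.split)

lemma moves_closed:
  assumes "(q', S', d, e) \<in> moves C q a S" and "is_control C q" and "S \<subseteq> {..C}"
  shows "is_control C q' \<and> S' \<subseteq> {..C} \<and>
    (a = Left_End \<longrightarrow> d \<noteq> Move_Left) \<and> (a = Right_End \<longrightarrow> d \<noteq> Move_Right)"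
proof (cases "(C, q, a, S)" rule: moves.cases)
  case (7 C' r a' S'')
  then show ?thesis
    using assms by (cases r) (auto split: if_splits)
qed (use assms in \<open>auto simp: is_control_first_sweep split: if_splits\<close>)

lemma well_formed_ballot_machine: "well_formed (ballot_machine C)"
proof -
  have "q \<in> states (ballot_machine C) \<and> s \<in> symbols (ballot_machine C) \<and>
      q' \<in> states (ballot_machine C) \<and> s' \<in> symbols (ballot_machine C) \<and>
      (a = Left_End \<longrightarrow> d \<noteq> Move_Left) \<and> (a = Right_End \<longrightarrow> d \<noteq> Move_Right)"
    if "(q, a, s, q', s', d, e) \<in> transitions (ballot_machine C)" for q a s q' s' d e
    using that by (auto simp: ballot_machine_def dest!: moves_closed)
  moreover have "finite (states (ballot_machine C))" "finite (symbols (ballot_machine C))"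
    "blank (ballot_machine C) \<in> symbols (ballot_machine C)"
    "start (ballot_machine C) \<in> states (ballot_machine C)"
    "accepting (ballot_machine C) \<subseteq> states (ballot_machine C)"
    using finite_controls by (auto simp: ballot_machine_def simp del: set_encode_empty)
  ultimately show ?thesis
    unfolding well_formed_def by fast
qed

text \<open>Configurations in terms of states and cell contents before their representation by
  numbers.\<close>

definition conf :: "control \<Rightarrow> int \<Rightarrow> int \<Rightarrow> (int \<Rightarrow> nat set) \<Rightarrow> (nat, nat) config" where
  "conf q i h T = Config (to_nat q) i h (set_encode \<circ> T)"

lemma step_ballot_machine_iff:
  assumes "is_control C q" and "T h \<subseteq> {..C}"
  shows "step (ballot_machine C) x (conf q i h T) c' \<longleftrightarrow>
    (\<exists>(q', S', d, e) \<in> moves C q (read_input x i) (T h).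
       c' = conf q' (i + offset d) (h + offset e) (T(h := S')))"
proof -
  have eq: "set_encode S = set_encode (T h) \<longleftrightarrow> S = T h" if "S \<subseteq> {..C}" for S
    using that assms(2) by (meson finite_atMost finite_subset set_encode_eq)
  have trans: "(to_nat q, a, set_encode (T h), r, s, d, e) \<in> transitions (ballot_machine C) \<longleftrightarrow>
      (\<exists>q' S'. r = to_nat q' \<and> s = set_encode S' \<and> (q', S', d, e) \<in> moves C q a (T h))"
    for a r s d e
    using assms eq by (auto simp: ballot_machine_def) metis+
  have "step (ballot_machine C) x (conf q i h T) c' \<longleftrightarrow>
      (\<exists>r s d e. (to_nat q, read_input x i, set_encode (T h), r, s, d, e)
           \<in> transitions (ballot_machine C) \<and>
         c' = Config r (i + offset d) (h + offset e) ((set_encode \<circ> T)(h := s)))"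
    by (auto simp: step.simps conf_def)
  then show ?thesis
    unfolding trans conf_def fun_upd_comp by (fastforce simp: Bex_def)
qed

section \<open>The space bound\<close>

text \<open>The positions of the work head on inputs of length n. Position -1 is where a rewinding
  head meets a blank cell. When L cells are in use, they are at the positions below L, and
  the head goes up to L, which is in the range if \<open>2 ^ L \<le> 2 * n + 1\<close>. This holds
  initially, where L is 0; and the cell L comes into use when a counter reaches
  \<open>2 ^ L \<le> n\<close>, so it remains true for L + 1.\<close>

definition head_range :: "nat \<Rightarrow> int set" where
  "head_range n = {h. -1 \<le> h \<and> 2 ^ nat h \<le> 2 * n + 1}"

lemma mem_head_range:
  assumes "2 ^ L \<le> 2 * n + 1" and "-1 \<le> h" and "h \<le> int L"
  shows "h \<in> head_range n"
proof -
  have "(2::nat) ^ nat h \<le> 2 ^ L"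
    using assms(3) by (intro power_increasing) auto
  then have "2 ^ nat h \<le> 2 * n + 1"
    using assms(1) by (rule order_trans)
  with assms(2) show ?thesis by (simp add: head_range_def)
qed

lemma head_range_subset: "head_range n \<subseteq> {-1..\<lfloor>log 2 (2 * real n + 1)\<rfloor>}"
proof
  fix h assume h: "h \<in> head_range n"
  then have "(2::real) ^ nat h \<le> 2 * real n + 1"
    unfolding head_range_def by (auto simp flip: of_nat_le_iff [where ?'a = real])
  then have "real (nat h) \<le> log 2 (2 * real n + 1)"
    by (simp add: le_log_iff powr_realpow)
  with h show "h \<in> {-1..\<lfloor>log 2 (2 * real n + 1)\<rfloor>}"
    by (auto simp: head_range_def le_floor_iff)
qed

lemma finite_head_range: "finite (head_range n)"
  using head_range_subset finite_subset by blast

lemma card_head_range: "real (card (head_range n)) \<le> log 2 (2 * real n + 1) + 2"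
proof -
  have "0 \<le> log 2 (2 * real n + 1)" by simp
  then have "real (card {-1..\<lfloor>log 2 (2 * real n + 1)\<rfloor>}) \<le> log 2 (2 * real n + 1) + 2"
    by (simp add: floor_le_iff)
  moreover have "card (head_range n) \<le> card {-1..\<lfloor>log 2 (2 * real n + 1)\<rfloor>}"
    by (intro card_mono head_range_subset) simp
  ultimately show ?thesis by linarith
qed

lemma card_head_range_bigo: "(\<lambda>n. real (card (head_range n))) \<in> O(\<lambda>n. ln (real n))"
  \<comment> \<open>For \<open>n \<ge> 2\<close>, \<open>2 n + 1 \<le> n ^ 3\<close> and \<open>2 \<le> 2 log n\<close>, with logarithms to base 2.\<close>
proof (rule bigoI [of _ "5 / ln 2"])
  show "\<forall>\<^sub>F n in sequentially. norm (real (card (head_range n))) \<le> 5 / ln 2 * norm (ln (real n))"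
    using eventually_ge_at_top [of 2]
  proof eventually_elim
    case (elim n)
    have n: "2 * real n + 1 \<le> real n ^ 3"
    proof -
      have "2 * (real n)\<^sup>2 \<le> real n ^ 3"
        using elim by (simp add: power2_eq_square power3_eq_cube)
      moreover have "4 * real n \<le> 2 * (real n)\<^sup>2" using elim by (simp add: power2_eq_square)
      moreover have "2 \<le> real n" using elim by simp
      ultimately show ?thesis by linarith
    qed
    have "log 2 (2 * real n + 1) \<le> log 2 (real n ^ 3)"
      using n elim by (intro log_mono) auto
    also have "\<dots> = 3 * log 2 (real n)"
      using elim by (simp add: log_nat_power)
    finally have "real (card (head_range n)) \<le> 3 * log 2 (real n) + 2 * log 2 2"
      using card_head_range [of n] by simp
    also have "\<dots> \<le> 5 * log 2 (real n)"
      using elim log_mono [of 2 2 "real n"] by simp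
    finally show ?case
      using elim by (simp add: log_def)
  qed
qed

section \<open>Tape contents\<close>

lemma set_bit_nat: "\<not> bit m j \<Longrightarrow> set_bit j m = m + 2 ^ j" for m :: nat
  by (simp add: set_bit_eq)

lemma unset_bit_nat: "bit m j \<Longrightarrow> unset_bit j m + 2 ^ j = m" for m :: nat
proof -
  assume "bit m j"
  then have "set_bit j (unset_bit j m) = m"
    by (intro bit_eqI) (auto simp: bit_simps)
  then show ?thesis
    by (metis bit_unset_bit_iff set_bit_nat)
qed

lemma set_bit_less: "m < 2 ^ L \<Longrightarrow> j < L \<Longrightarrow> set_bit j m < 2 ^ L" for m :: nat
  by (metis leD take_bit_nat_eq_self_iff take_bit_set_bit_eq)

lemma bit_imp_power_le: "bit m j \<Longrightarrow> 2 ^ j \<le> m" for m :: nat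
  using unset_bit_nat [of m j] by linarith

text \<open>The contents of the tape when L cells are in use and the counter k holds the number
  \<^term>\<open>d k\<close>.\<close>

definition cells :: "nat \<Rightarrow> nat \<Rightarrow> (nat \<Rightarrow> nat) \<Rightarrow> int \<Rightarrow> nat set" where
  "cells C L d = (\<lambda>h. if 0 \<le> h \<and> h < int L then insert C {k. k < C \<and> bit (d k) (nat h)} else {})"

lemma cells_subset: "cells C L d h \<subseteq> {..C}"
  by (auto simp: cells_def)

lemma cells_marker: "C \<in> cells C L d h \<longleftrightarrow> 0 \<le> h \<and> h < int L"
  by (auto simp: cells_def)

lemma cells_digit: "k < C \<Longrightarrow> j < L \<Longrightarrow> k \<in> cells C L d (int j) \<longleftrightarrow> bit (d k) j"
  by (auto simp: cells_def)

lemma cells_blank: "h < 0 \<or> int L \<le> h \<Longrightarrow> cells C L d h = {}"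
  by (auto simp: cells_def)

lemma cells_unset_bit:
  assumes "k < C" and "j < L"
  shows "(cells C L d)(int j := cells C L d (int j) - {k}) = cells C L (d(k := unset_bit j (d k)))"
  using assms by (auto simp: cells_def fun_eq_iff bit_simps)

lemma cells_set_bit:
  assumes "k < C" and "j < L"
  shows "(cells C L d)(int j := insert k (cells C L d (int j)))
    = cells C L (d(k := set_bit j (d k)))"
  using assms by (auto simp: cells_def fun_eq_iff bit_simps)

lemma cells_append:
  assumes "k < C" and "\<forall>k<C. d k < 2 ^ L"
  shows "(cells C L d)(int L := {C, k}) = cells C (Suc L) (d(k := set_bit L (d k)))"
proof
  fix h
  have "\<not> bit (d k') L" if "k' < C" for k'
    using assms(2) that bit_imp_power_le not_le by blast
  moreover have "h < 1 + int L \<longleftrightarrow> h = int L \<or> h < int L" by auto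
  ultimately show "((cells C L d)(int L := {C, k})) h = cells C (Suc L) (d(k := set_bit L (d k))) h"
    using assms(1) by (auto simp: cells_def bit_simps)
qed

section \<open>The machine carries out the recursion\<close>

text \<open>The number that the counter k holds when the heights are h. The height after the last one
  counts as 0, so that the last counter holds the last height.\<close>

definition diffs :: "nat list \<Rightarrow> nat \<Rightarrow> nat" where
  "diffs h k = h ! k - (if Suc k < length h then h ! Suc k else 0)"

lemma diffs_add_at_0:
  assumes "h \<noteq> []" and "sorted_wrt (\<ge>) h"
  shows "diffs (add_at 0 h) = (diffs h)(0 := diffs h 0 + 1)"
  using assms
  by (auto simp: diffs_def add_at_def fun_eq_iff sorted_ge_iff_nth nth_list_update Suc_diff_le)

lemma diffs_add_at_Suc:
  assumes "Suc k < length h" and "sorted_wrt (\<ge>) h" and "addable (Suc k) h"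
  shows "diffs (add_at (Suc k) h) = (diffs h)(k := diffs h k - 1, Suc k := diffs h (Suc k) + 1)"
  using assms
  by (auto simp: diffs_def add_at_def addable_def fun_eq_iff sorted_ge_iff_nth
      nth_list_update Suc_diff_le)

text \<open>The number C of letters and the input word x are fixed from here on.\<close>

context
  fixes C :: nat and x :: "bool list"
begin

text \<open>From state q, with the input head at i, the work head at h and tape T, the computation on
  x halts within the space bound and has the given number of accepting paths.\<close>

abbreviation yields :: "control \<Rightarrow> int \<Rightarrow> int \<Rightarrow> (int \<Rightarrow> nat set) \<Rightarrow> nat \<Rightarrow> bool" where
  "yields q i h T \<equiv> counted (ballot_machine C) x (head_range (length x)) (conf q i h T)"

lemma yields_stop:
  assumes "moves C q (read_input x i) (T h) = {}"
    and "is_control C q" and "T h \<subseteq> {..C}" and "h \<in> head_range (length x)"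
  shows "yields q i h T (if q = Accept then 1 else 0)"
proof -
  let ?c = "conf q i h T"
  have "halted (ballot_machine C) x ?c"
    unfolding halted_def using assms by (simp add: step_ballot_machine_iff)
  then have "counted (ballot_machine C) x (head_range (length x)) ?c
      (if state ?c \<in> accepting (ballot_machine C) then 1 else 0)"
    using assms by (intro counted.halted) (simp_all add: conf_def)
  then show ?thesis
    by (simp add: conf_def ballot_machine_def)
qed

text \<open>Choices that differ only in the next state lead to distinct configurations, so their
  numbers of accepting paths add up.\<close>

lemma yields_choice:
  assumes moves: "moves C q (read_input x i) (T h) = (\<lambda>v. (F v, S', d, e)) ` I"
    and "finite I" and "I \<noteq> {}" and inj: "inj_on F I"
    and q: "is_control C q" "T h \<subseteq> {..C}" and "h \<in> head_range (length x)"
    and N: "\<And>v. v \<in> I \<Longrightarrow> yields (F v) (i + offset d) (h + offset e) (T(h := S')) (N v)"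
  shows "yields q i h T (\<Sum>v\<in>I. N v)"
proof -
  let ?G = "\<lambda>v. conf (F v) (i + offset d) (h + offset e) (T(h := S'))"
  let ?c = "conf q i h T"
  have step: "step (ballot_machine C) x ?c c' \<longleftrightarrow> c' \<in> ?G ` I" for c'
    using q by (auto simp: step_ballot_machine_iff moves)
  have injG: "inj_on ?G I"
    using inj by (auto simp: inj_on_def conf_def)
  have "counted (ballot_machine C) x (head_range (length x)) ?c
      (\<Sum>c' | step (ballot_machine C) x ?c c'. N (inv_into I ?G c'))"
  proof (rule counted.branch)
    show "work_pos ?c \<in> head_range (length x)"
      using assms by (simp add: conf_def)
    show "\<not> halted (ballot_machine C) x ?c"
      using \<open>I \<noteq> {}\<close> by (auto simp: halted_def step)
    show "finite {c'. step (ballot_machine C) x ?c c'}"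
      using \<open>finite I\<close> by (simp add: step)
    show "counted (ballot_machine C) x (head_range (length x)) c' (N (inv_into I ?G c'))"
      if "step (ballot_machine C) x ?c c'" for c'
    proof -
      from that obtain v where "v \<in> I" "c' = ?G v" by (auto simp: step)
      then show ?thesis
        using N [of v] inv_into_f_f [OF injG, of v] by simp
    qed
  qed
  moreover have "(\<Sum>c' | step (ballot_machine C) x ?c c'. N (inv_into I ?G c')) = (\<Sum>v\<in>I. N v)"
    by (simp add: step sum.reindex [OF injG] inv_into_f_f [OF injG])
  ultimately show ?thesis by simp
qed

lemma yields_move:
  assumes "yields q' i' h' T' N"
    and "moves C q (read_input x i) (T h) = {(q', S', d, e)}"
    and "i' = i + offset d" and "h' = h + offset e" and "T' = T(h := S')"
    and "is_control C q" and "T h \<subseteq> {..C}" and "h \<in> head_range (length x)"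
  shows "yields q i h T N"
  using yields_choice [of q i T h "\<lambda>_. q'" S' d e "{()}" "\<lambda>_. N"] assms by simp

text \<open>The numbers d have at most L digits, and L cells obey the space bound.\<close>

definition fits :: "nat \<Rightarrow> (nat \<Rightarrow> nat) \<Rightarrow> bool" where
  "fits L d \<longleftrightarrow> 2 ^ L \<le> 2 * length x + 1 \<and> (\<forall>k<C. d k < 2 ^ L)"

lemma fits_head_range: "fits L d \<Longrightarrow> -1 \<le> h \<Longrightarrow> h \<le> int L \<Longrightarrow> h \<in> head_range (length x)"
  unfolding fits_def using mem_head_range by blast

lemma yields_Rewind:
  assumes "is_control C (Rewind q)" and "fits L d" and "j \<le> L"
    and "yields q i 0 (cells C L d) N"
  shows "yields (Rewind q) i (int j - 1) (cells C L d) N"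
  using assms(3)
proof (induction j)
  case 0
  from assms(4) show ?case
    by (rule yields_move [where S' = "cells C L d (-1)" and d = Stay and e = Move_Right])
      (use assms in \<open>auto simp: cells_marker cells_subset intro: fits_head_range\<close>)
next
  case (Suc j)
  then have "yields (Rewind q) i (int j - 1) (cells C L d) N" by simp
  then show ?case
    by (rule yields_move [where S' = "cells C L d (int j)" and d = Stay and e = Move_Left])
      (use Suc assms in \<open>auto simp: cells_marker cells_subset intro: fits_head_range\<close>)
qed

text \<open>When the sweep has reached position j, the lower digits are done and \<open>2 ^ j\<close> remains to be
  added. A further cell comes into use only if the sum is at least \<open>2 ^ L\<close>; as it does not
  exceed the length of the input, the space bound survives.\<close>

lemma yields_Inc:
  assumes "i < C" and "p \<le> C" and "j \<le> L" and "fits L d" and "d i + 2 ^ j \<le> length x"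
    and "\<And>L'. fits L' (d(i := d i + 2 ^ j)) \<Longrightarrow>
      yields (Main p) pos 0 (cells C L' (d(i := d i + 2 ^ j))) N"
  shows "yields (Inc i p) pos (int j) (cells C L d) N"
  using assms(3-)
proof (induction "L - j" arbitrary: j d)
  case 0
  \<comment> \<open>The carry has reached the blank cell L, which now comes into use.\<close>
  let ?d = "d(i := set_bit L (d i))"
  have j: "j = L" using 0 by simp
  have "\<not> bit (d i) L"
    using 0(3) assms(1) bit_imp_power_le not_le unfolding fits_def by blast
  then have eq: "set_bit L (d i) = d i + 2 ^ L" by (rule set_bit_nat)
  have fits: "fits (Suc L) ?d"
    using 0(3,4) assms(1) unfolding fits_def eq j by (auto intro: trans_less_add1)
  have "yields (Main p) pos 0 (cells C (Suc L) ?d) N"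
    using 0(5) [of "Suc L"] fits unfolding j eq by blast
  then have "yields (Rewind (Main p)) pos (int L - 1) (cells C (Suc L) ?d) N"
    using assms fits by (intro yields_Rewind) auto
  then show ?case
    by (rule yields_move [where S' = "{C, i}" and d = Stay and e = Move_Left])
      (use assms 0(3) j cells_append [of i C d L] in
        \<open>auto simp: cells_blank fits_def intro: fits_head_range [OF 0(3)]\<close>)
next
  case (Suc m)
  then have j: "j < L" by simp
  show ?case
  proof (cases "bit (d i) j")
    case True
    let ?d = "d(i := unset_bit j (d i))"
    note eq = unset_bit_nat [OF True]
    have sum: "?d i + 2 ^ Suc j = d i + 2 ^ j" using eq by simp
    have "fits L ?d"
      using Suc.prems(2) eq assms(1) unfolding fits_def by (auto intro: le_less_trans [of _ "d i"])
    moreover have "?d(i := ?d i + 2 ^ Suc j) = d(i := d i + 2 ^ j)"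
      unfolding sum by simp
    ultimately have "yields (Inc i p) pos (int (Suc j)) (cells C L ?d) N"
      using Suc j sum by (intro Suc.hyps(1)) (auto simp del: fun_upd_apply)
    then show ?thesis
      by (rule yields_move [where S' = "cells C L d (int j) - {i}" and d = Stay and e = Move_Right])
        (use assms(1,2) j True cells_unset_bit [of i C j L d] Suc.prems(2) in
          \<open>auto simp: cells_digit cells_subset add.commute
            intro: fits_head_range\<close>)
  next
    case False
    let ?d = "d(i := set_bit j (d i))"
    note eq = set_bit_nat [OF False]
    have fits: "fits L ?d"
      using Suc.prems(2) set_bit_less j assms(1) unfolding fits_def by auto
    then have "yields (Main p) pos 0 (cells C L ?d) N"
      using Suc.prems(4) [of L] unfolding eq by blast
    then have main: "yields (Rewind (Main p)) pos (int j - 1) (cells C L ?d) N"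
      using assms fits j by (intro yields_Rewind) auto
    have ins: "insert C (insert i (cells C L d (int j))) = insert i (cells C L d (int j))"
      using j cells_marker [of C L d "int j"] by auto
    from main show ?thesis
      by (rule yields_move [where S' = "insert i (cells C L d (int j))"
          and d = Stay and e = Move_Left])
        (use assms(1,2) j False ins cells_set_bit [of i C j L d] Suc.prems(2) in
          \<open>auto simp: cells_digit cells_subset intro: fits_head_range\<close>)
  qed
qed

text \<open>Likewise, \<open>2 ^ j\<close> remains to be subtracted at position j. At a digit 0 this amounts to
  adding \<open>2 ^ j\<close> here and subtracting \<open>2 ^ (j + 1)\<close> from the next position on.\<close>

lemma yields_Dec:
  assumes "Suc k < C" and "p \<le> C" and "j \<le> L" and "fits L d"
    and "2 ^ j \<le> d k \<Longrightarrow> fits L (d(k := d k - 2 ^ j)) \<Longrightarrow>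
      yields (Inc (Suc k) p) pos 0 (cells C L (d(k := d k - 2 ^ j))) N"
  shows "yields (Dec k p) pos (int j) (cells C L d) (if 2 ^ j \<le> d k then N else 0)"
  using assms(3-)
proof (induction "L - j" arbitrary: j d)
  case 0
  then have "j = L" "\<not> 2 ^ j \<le> d k"
    using assms(1) by (auto simp: fits_def not_le)
  then show ?case
    using yields_stop [of "Dec k p" pos "cells C L d" "int L"] assms(1,2) fits_head_range [OF 0(3)]
    by (simp add: cells_blank)
next
  case (Suc m)
  then have j: "j < L" by simp
  show ?case
  proof (cases "bit (d k) j")
    case True
    let ?d = "d(k := unset_bit j (d k))"
    note eq = unset_bit_nat [OF True]
    then have diff: "unset_bit j (d k) = d k - 2 ^ j" and le: "2 ^ j \<le> d k" by linarith+
    have fits: "fits L ?d"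
      using Suc.prems(2) eq assms(1) unfolding fits_def by (auto intro: le_less_trans [of _ "d k"])
    then have "yields (Inc (Suc k) p) pos 0 (cells C L ?d) N"
      using Suc.prems(3) le unfolding diff by blast
    then have "yields (Rewind (Inc (Suc k) p)) pos (int j - 1) (cells C L ?d)
        (if 2 ^ j \<le> d k then N else 0)"
      using assms fits j le by (intro yields_Rewind) auto
    then show ?thesis
      by (rule yields_move [where S' = "cells C L d (int j) - {k}" and d = Stay and e = Move_Left])
        (use assms(1,2) j True cells_unset_bit [of k C j L d] Suc.prems(2) le in
          \<open>auto simp: cells_digit cells_marker cells_subset intro: fits_head_range\<close>)
  next
    case False
    let ?d = "d(k := set_bit j (d k))"
    note eq = set_bit_nat [OF False]
    have "fits L ?d"
      using Suc.prems(2) set_bit_less j assms(1) unfolding fits_def by auto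
    moreover have "?d(k := ?d k - 2 ^ Suc j) = d(k := d k - 2 ^ j)"
      using eq by simp
    moreover have iff: "2 ^ Suc j \<le> ?d k \<longleftrightarrow> 2 ^ j \<le> d k"
      using eq by simp
    ultimately have "yields (Dec k p) pos (int (Suc j)) (cells C L ?d)
        (if 2 ^ Suc j \<le> ?d k then N else 0)"
      using Suc j by (intro Suc.hyps(1)) (auto simp del: fun_upd_apply)
    then show ?thesis
      unfolding iff
      by (rule yields_move [where S' = "insert k (cells C L d (int j))"
          and d = Stay and e = Move_Right])
        (use assms(1,2) j False cells_set_bit [of k C j L d] Suc.prems(2) in
          \<open>auto simp: cells_digit cells_marker cells_subset add.commute
            intro: fits_head_range\<close>)
  qed
qed

text \<open>The work on the counters for one letter takes the representation of the old heights to
  that of the new ones, or ends in rejection if the letter may not be appended.\<close>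

lemma yields_letter:
  assumes "i < C" and "p \<le> C" and "length h = C" and "sorted_wrt (\<ge>) h" and "fits L (diffs h)"
    and "Suc (h ! i) \<le> length x"
    and cont: "\<And>L'. addable i h \<Longrightarrow> fits L' (diffs (add_at i h)) \<Longrightarrow>
      yields (Main p) pos 0 (cells C L' (diffs (add_at i h))) N"
  shows "yields (first_sweep i p) pos 0 (cells C L (diffs h)) (if addable i h then N else 0)"
proof (cases i)
  case 0
  then have "diffs (add_at i h) = (diffs h)(0 := diffs h 0 + 2 ^ 0)"
    using assms diffs_add_at_0 by auto
  moreover have "diffs h 0 \<le> h ! 0" by (simp add: diffs_def)
  ultimately show ?thesis
    using 0 assms yields_Inc [of 0 p 0 L "diffs h" pos N]
    by (simp add: first_sweep_def addable_def)
next
  case (Suc k)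
  let ?d = "(diffs h)(k := diffs h k - 2 ^ 0)"
  have addable: "addable i h \<longleftrightarrow> 2 ^ 0 \<le> diffs h k"
    using Suc assms by (auto simp: addable_def diffs_def)
  have "yields (Dec k p) pos (int 0) (cells C L (diffs h)) (if 2 ^ 0 \<le> diffs h k then N else 0)"
  proof (rule yields_Dec)
    assume le: "2 ^ 0 \<le> diffs h k" and fits: "fits L ?d"
    then have eq: "diffs (add_at i h) = ?d(i := ?d i + 2 ^ 0)"
      using assms addable Suc diffs_add_at_Suc by auto
    have "diffs h i \<le> h ! i" by (simp add: diffs_def)
    then have "yields (Inc i p) pos (int 0) (cells C L ?d) N"
      using assms fits eq addable le Suc
      by (intro yields_Inc) (auto simp del: fun_upd_apply simp: fun_upd_other)
    then show "yields (Inc (Suc k) p) pos 0 (cells C L ?d) N"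
      using Suc by simp
  qed (use assms Suc in auto)
  then show ?thesis
    unfolding addable using Suc by (simp add: first_sweep_def)
qed

lemma inj_on_first_sweep: "inj_on (\<lambda>i. first_sweep i p) I"
  by (auto simp: inj_on_def first_sweep_def split: nat.splits)

text \<open>Here y is the part of the input that has been read. As each 1 in it raised one height by
  one, no height exceeds its length.\<close>

lemma yields_Main:
  assumes "x = y @ s" and "p \<le> C" and "length h = C" and "sorted_wrt (\<ge>) h"
    and "\<forall>k<C. h ! k \<le> length y" and "fits L (diffs h)"
  shows "yields (Main p) (int (length y) + 1) 0 (cells C L (diffs h)) (runs p h s)"
  using assms
proof (induction s arbitrary: y p h L)
  case Nil
  have inp: "read_input x (int (length y) + 1) = Right_End"
    using Nil by (simp add: read_input_def)
  have head: "0 \<in> head_range (length x)"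
    using fits_head_range [OF Nil.prems(6)] by simp
  show ?case
  proof (cases "p = C")
    case True
    have "yields Accept (int (length y) + 1) 0 (cells C L (diffs h)) (runs p h [])"
      using yields_stop [of Accept] cells_subset head True Nil by simp
    then show ?thesis
      by (rule yields_move [where S' = "cells C L (diffs h) 0" and d = Stay and e = Stay])
        (use True inp head Nil in \<open>auto simp: cells_subset\<close>)
  next
    case False
    then show ?thesis
      using yields_stop [of "Main p" "int (length y) + 1" "cells C L (diffs h)" 0] inp head Nil
      by (simp add: cells_subset)
  qed
next
  case (Cons b s)
  have inp: "read_input x (int (length y) + 1) = Letter b"
    using Cons.prems(1) by (simp add: read_input_def nth_append)
  have head: "0 \<in> head_range (length x)"
    using fits_head_range [OF Cons.prems(6)] by simp
  have x: "x = (y @ [b]) @ s" using Cons.prems(1) by simp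
  have pos: "int (length y) + 1 + 1 = int (length (y @ [b])) + 1" by simp
  show ?case
  proof (cases b)
    case False
    show ?thesis
    proof (cases "p < C")
      case True
      then have "yields (Main (Suc p)) (int (length (y @ [b])) + 1) 0 (cells C L (diffs h))
          (runs p h (b # s))"
        using Cons.IH [of "y @ [b]" "Suc p" h L] Cons.prems x False by (simp add: le_SucI)
      then show ?thesis
        by (rule yields_move [where S' = "cells C L (diffs h) 0" and d = Move_Right and e = Stay])
          (use True False inp head Cons.prems in \<open>auto simp: cells_subset add_ac\<close>)
    next
      assume "\<not> p < C"
      then show ?thesis
        using yields_stop [of "Main p" "int (length y) + 1" "cells C L (diffs h)" 0]
          inp head Cons.prems False
        by (simp add: cells_subset)
    qed
  next
    case True
    let ?I = "if p < C then {p} else {..<C}"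
    have letter: "yields (first_sweep i p) (int (length y) + 1 + 1) 0 (cells C L (diffs h))
        (if addable i h then runs p (add_at i h) s else 0)" if "i \<in> ?I" for i
    proof (rule yields_letter)
      show "i < C" using that by (auto split: if_splits)
      then have "h ! i \<le> length y" using Cons.prems(5) by simp
      then show "Suc (h ! i) \<le> length x" using Cons.prems(1) by simp
      fix L' assume "addable i h" and "fits L' (diffs (add_at i h))"
      moreover have "\<forall>k<C. add_at i h ! k \<le> length (y @ [b])"
        using Cons.prems(3,5) \<open>i < C\<close> by (simp add: add_at_def nth_list_update le_SucI)
      ultimately show "yields (Main p) (int (length y) + 1 + 1) 0 (cells C L' (diffs (add_at i h)))
          (runs p (add_at i h) s)"
        unfolding pos using Cons.prems x \<open>i < C\<close>
        by (intro Cons.IH) (simp_all add: sorted_add_at_iff)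
    qed (use Cons.prems in auto)
    have moves: "moves C (Main p) (read_input x (int (length y) + 1)) (cells C L (diffs h) 0)
        = (\<lambda>i. (first_sweep i p, cells C L (diffs h) 0, Move_Right, Stay)) ` ?I"
      using True inp by simp
    show ?thesis
    proof (cases "?I = {}")
      case True': True
      \<comment> \<open>This happens only if C is 0, when there is no letter to choose.\<close>
      then have "moves C (Main p) (read_input x (int (length y) + 1)) (cells C L (diffs h) 0) = {}"
        using moves by simp
      moreover have "runs p h (b # s) = 0"
      proof -
        have "h = []"
          using True' Cons.prems(2,3) by (cases "p < C") auto
        with True show ?thesis by simp
      qed
      ultimately show ?thesis
        using yields_stop [of "Main p" "int (length y) + 1" "cells C L (diffs h)" 0] head Cons.prems
        by (simp add: cells_subset)
    next
      case False
      have "yields (Main p) (int (length y) + 1) 0 (cells C L (diffs h))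
          (\<Sum>i\<in>?I. if addable i h then runs p (add_at i h) s else 0)"
      proof (rule yields_choice [where T = "cells C L (diffs h)" and h = 0, OF moves])
        fix i assume "i \<in> ?I"
        then show "yields (first_sweep i p) (int (length y) + 1 + offset Move_Right) (0 + offset Stay)
            ((cells C L (diffs h))(0 := cells C L (diffs h) 0))
            (if addable i h then runs p (add_at i h) s else 0)"
          using letter by simp
      qed (use False head Cons.prems(2) in \<open>simp_all add: cells_subset inj_on_first_sweep\<close>)
      then show ?thesis
        using True Cons.prems(3) by (simp only: runs.simps)
    qed
  qed
qed

lemma yields_initial:
  "counted (ballot_machine C) x (head_range (length x)) (initial (ballot_machine C))
     (runs 0 (replicate C 0) x)"
proof -
  let ?h = "replicate C (0::nat)"
  have blank: "cells C 0 d = (\<lambda>_. {})" for d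
    by (simp add: cells_def fun_eq_iff)
  have fits: "fits 0 (diffs ?h)"
    by (auto simp: fits_def diffs_def)
  have "yields (Main 0) (int (length ([] :: bool list)) + 1) 0 (cells C 0 (diffs ?h)) (runs 0 ?h x)"
    using fits by (intro yields_Main) (auto simp: sorted_ge_iff_nth)
  then have "yields (Main 0) 0 0 (cells C 0 (diffs ?h)) (runs 0 ?h x)"
    by (rule yields_move [where S' = "{}" and d = Move_Right and e = Stay])
      (use fits_head_range [OF fits, of 0] in \<open>auto simp: blank read_input_def\<close>)
  then show ?thesis
    by (simp add: blank conf_def initial_def ballot_machine_def comp_def)
qed

end

theorem theorem3p13:
  fixes C :: nat
  shows "on_strings encode {(a, n). length a = C \<and> sorted_wrt (\<ge>) a}
           (\<lambda>(a, n). ballot_number n a) \<in> sharpL"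
proof (rule sharpL_if_counted)
  show "well_formed (ballot_machine C)" by (rule well_formed_ballot_machine)
  show "finite (head_range n)" for n by (rule finite_head_range)
  show "(\<lambda>n. real (card (head_range n))) \<in> O(\<lambda>n. ln (real n))" by (rule card_head_range_bigo)
  show "counted (ballot_machine C) x (head_range (length x)) (initial (ballot_machine C))
      (on_strings encode {(a, n). length a = C \<and> sorted_wrt (\<ge>) a}
         (\<lambda>(a, n). ballot_number n a) x)" for x
    using yields_initial [of C x] unfolding runs_eq_on_strings .
qed

end
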